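(* Up to changes of the pseudo-arc parameter, up to the orientation of the curve, and up to isometries of $\mathbb E^3_1$, the null slant helices in the 3-dimensional Minkowski spacetime $\mathbb E^3_1$ which are not general helices are precisely the curves belonging to the following four classes (each curve being considered on an open subinterval of $(0,\infty)$, with pseudo-arc parameter $s>0$): (a) $$\alpha(s)=\frac{s^2}{8}\left(2(2\ln s-1),\;2\ln^2 s-2\ln s-1,\;2\ln^2 s-2\ln s+3\right),$$ which has torsion $\tau=\dfrac{1}{2s^2}$; (b) for a real constant $a>1$ and $b=\sqrt{a-1}$, $$\alpha(s)=\frac{s^2}{b}\left(\frac{2\sin(\ln s^b)-b\cos(\ln s^b)}{b^2+4},\;-\frac{2\cos(\ln s^b)+b\sin(\ln s^b)}{b^2+4},\;\frac12\right),$$ which has torsion $\tau=\dfrac{a}{2s^2}$; (c) for a real constant $a<1$ with $a\neq0$, $a\neq-3$, and $b=\sqrt{1-a}$, $$\alpha(s)=\frac{s^2}{2b}\left(-1,\;\frac{s^{-b}}{b-2}+\frac{s^b}{b+2},\;\frac{s^{-b}}{b-2}-\frac{s^b}{b+2}\right),$$ which has torsion $\tau=\dfrac{a}{2s^2}$; (d) $$\alpha(s)=\frac{1}{16}\left(-4s^2,\;s^4-4\ln s,\;-s^4-4\ln s\right),$$ which has torsion $\tau=-\dfrac{3}{2s^2}$.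
   Context: $\mathbb E^3_1$ denotes $\mathbb R^3$ with Cartesian coordinates $(x,y,z)$ and the Minkowski metric $g=dx^2+dy^2-dz^2$. All curves are smooth. A curve $\alpha\colon I\to\mathbb E^3_1$ ($I$ an open interval) is null if $g(\alpha',\alpha')=0$ on $I$. All null curves are assumed non-degenerate, i.e. $\alpha',\alpha'',\alpha'''$ are linearly independent at every point; then $g(\alpha'',\alpha'')>0$. All null curves are taken to be parametrized by a pseudo-arc parameter $s$, i.e. a parameter for which $g(\alpha'',\alpha'')=1$; such a parameter is unique up to changes $s\mapsto\pm s+\mathrm{const}$. The torsion of such a curve is $\tau=\tfrac12 g(\alpha''',\alpha''')$. A null curve $\alpha$ (with pseudo-arc parameter) is a slant helix if there is a non-zero constant vector $V$ in $\mathbb E^3_1$ such that $g(\alpha'',V)=c$ is constant along $\alpha$. It is a general helix if there is a non-zero constant vector $V$ such that $g(\alpha',V)$ is constant along $\alpha$ (equivalently $g(\alpha'',V)=0$). The orientation of $\alpha$ is the sign of $\det[\alpha',\alpha'',\alpha''']$. Isometries of $\mathbb E^3_1$ are all affine maps whose linear part preserves $g$ (including orientation-reversing ones). Thus two curves are identified if one is obtained from the other by a change of parameter $s\mapsto\pm s+\mathrm{const}$ and an isometry of $\mathbb E^3_1$, possibly reversing the orientation of the curve. *)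

theory Defs
  imports "HOL-Analysis.Analysis"
begin

definition mink :: "real^3 \<Rightarrow> real^3 \<Rightarrow> real" where
  "mink u v = u$1 * v$1 + u$2 * v$2 - u$3 * v$3"

definition open_interval :: "real set \<Rightarrow> bool" where
  "open_interval I \<longleftrightarrow> open I \<and> is_interval I \<and> I \<noteq> {}"

text \<open>
  A curve on \<open>I\<close> is a total function of which only the values on \<open>I\<close> matter: since \<open>I\<close> is open,
  the iterated derivatives below are unaffected by the values outside \<open>I\<close>.
\<close>

definition nderiv :: "nat \<Rightarrow> (real \<Rightarrow> real^3) \<Rightarrow> real \<Rightarrow> real^3" where
  "nderiv n \<alpha> = ((\<lambda>f t. vector_derivative f (at t)) ^^ n) \<alpha>"

definition smooth_curve :: "real set \<Rightarrow> (real \<Rightarrow> real^3) \<Rightarrow> bool" where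
  "smooth_curve I \<alpha> \<longleftrightarrow> (\<forall>n. \<forall>s\<in>I. nderiv n \<alpha> differentiable (at s))"

text \<open>The distinctness makes this linear independence of the family, not only of the set.\<close>

definition lin_indep3 :: "real^3 \<Rightarrow> real^3 \<Rightarrow> real^3 \<Rightarrow> bool" where
  "lin_indep3 u v w \<longleftrightarrow> distinct [u, v, w] \<and> independent {u, v, w}"

text \<open>Non-degenerate null curves parametrized by a pseudo-arc parameter.\<close>

definition null_curve :: "real set \<Rightarrow> (real \<Rightarrow> real^3) \<Rightarrow> bool" where
  "null_curve I \<alpha> \<longleftrightarrow>
     open_interval I \<and> smooth_curve I \<alpha> \<and>
     (\<forall>s\<in>I. mink (nderiv 1 \<alpha> s) (nderiv 1 \<alpha> s) = 0) \<and>
     (\<forall>s\<in>I. lin_indep3 (nderiv 1 \<alpha> s) (nderiv 2 \<alpha> s) (nderiv 3 \<alpha> s)) \<and>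
     (\<forall>s\<in>I. mink (nderiv 2 \<alpha> s) (nderiv 2 \<alpha> s) = 1)"

definition torsion :: "(real \<Rightarrow> real^3) \<Rightarrow> real \<Rightarrow> real" where
  "torsion \<alpha> s = 1/2 * mink (nderiv 3 \<alpha> s) (nderiv 3 \<alpha> s)"

definition null_slant_helix :: "real set \<Rightarrow> (real \<Rightarrow> real^3) \<Rightarrow> bool" where
  "null_slant_helix I \<alpha> \<longleftrightarrow>
     null_curve I \<alpha> \<and> (\<exists>V. V \<noteq> 0 \<and> (\<exists>c. \<forall>s\<in>I. mink (nderiv 2 \<alpha> s) V = c))"

definition null_general_helix :: "real set \<Rightarrow> (real \<Rightarrow> real^3) \<Rightarrow> bool" where
  "null_general_helix I \<alpha> \<longleftrightarrow>
     null_curve I \<alpha> \<and> (\<exists>V. V \<noteq> 0 \<and> (\<exists>c. \<forall>s\<in>I. mink (nderiv 1 \<alpha> s) V = c))"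

definition mink_isometry :: "(real^3 \<Rightarrow> real^3) \<Rightarrow> bool" where
  "mink_isometry \<Phi> \<longleftrightarrow>
     (\<exists>A p. linear A \<and> (\<forall>u v. mink (A u) (A v) = mink u v) \<and> (\<forall>x. \<Phi> x = A x + p))"

text \<open>
  No condition is imposed on the orientation of the curves: both the change of parameter and the
  isometry may reverse it.
\<close>

definition congruent_curves ::
    "real set \<Rightarrow> (real \<Rightarrow> real^3) \<Rightarrow> real set \<Rightarrow> (real \<Rightarrow> real^3) \<Rightarrow> bool" where
  "congruent_curves I \<alpha> J \<beta> \<longleftrightarrow>
     (\<exists>\<epsilon> d \<Phi>. (\<epsilon> = 1 \<or> \<epsilon> = -1) \<and> mink_isometry \<Phi> \<and>
        J = (\<lambda>s. \<epsilon> * s + d) ` I \<and> (\<forall>s\<in>I. \<alpha> s = \<Phi> (\<beta> (\<epsilon> * s + d))))"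

definition curve_a :: "real \<Rightarrow> real^3" where
  "curve_a s = (s^2 / 8) *\<^sub>R vector
     [2 * (2 * ln s - 1),
      2 * (ln s)^2 - 2 * ln s - 1,
      2 * (ln s)^2 - 2 * ln s + 3]"

definition curve_b :: "real \<Rightarrow> real \<Rightarrow> real^3" where
  "curve_b a s = (let b = sqrt (a - 1) in
     (s^2 / b) *\<^sub>R vector
     [(2 * sin (ln (s powr b)) - b * cos (ln (s powr b))) / (b^2 + 4),
      - ((2 * cos (ln (s powr b)) + b * sin (ln (s powr b))) / (b^2 + 4)),
      1/2])"

definition curve_c :: "real \<Rightarrow> real \<Rightarrow> real^3" where
  "curve_c a s = (let b = sqrt (1 - a) in
     (s^2 / (2 * b)) *\<^sub>R vector
     [-1,
      s powr (-b) / (b - 2) + s powr b / (b + 2),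
      s powr (-b) / (b - 2) - s powr b / (b + 2)])"

definition curve_d :: "real \<Rightarrow> real^3" where
  "curve_d s = (1/16) *\<^sub>R vector
     [- 4 * s^2,
      s^4 - 4 * ln s,
      - (s^4) - 4 * ln s]"

end

theory Submission
  imports Defs
begin

text \<open>
  Write \<open>T = \<alpha>'\<close>, \<open>N = \<alpha>''\<close>, \<open>B = \<alpha>''' + \<tau> T\<close>. These satisfy \<open>T' = N\<close>, \<open>N' = B - \<tau> T\<close>,
  \<open>B' = - \<tau> N\<close>, and every \<open>v\<close> equals \<open>- g(v,B) T + g(v,N) N - g(v,T) B\<close>.
  For two curves with the same torsion, the linear map carrying one frame to the other therefore has
  derivative zero, so the torsion determines the curve up to an isometry.
  If \<open>g(N,V) = c\<close>, then \<open>f = g(T,V)\<close> has slope \<open>c\<close> and \<open>g(B,V) = \<tau> f\<close>, whence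
  \<open>(\<tau> f\<^sup>2)' = 0\<close>; conversely, if \<open>\<tau> = a / (2 f\<^sup>2)\<close> with \<open>f\<close> affine, then
  \<open>V = - (a / (2 f)) T + f' N - f B\<close> is constant. So the slant helices that are not general helices
  are the curves with \<open>\<tau> = a / (2 s\<^sup>2)\<close> and \<open>a \<noteq> 0\<close> up to a change of parameter,
  and for each such \<open>a\<close> one of the four families contains a curve with this torsion.
\<close>

section \<open>The Minkowski product and iterated derivatives\<close>

interpretation mink: bounded_bilinear mink
  by (simp add: bilinear_conv_bounded_bilinear[symmetric] bilinear_def linear_iff mink_def algebra_simps)

declare One_nat_def [simp del] \<comment> \<open>would rewrite \<open>nderiv 1\<close> to \<open>nderiv (Suc 0)\<close>\<close>

declare mink.zero_left [simp] mink.zero_right [simp]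

lemma mink_commute: "mink u v = mink v u"
  by (simp add: mink_def mult.commute)

lemmas mink_linear_simps =
  mink.add_left mink.add_right mink.diff_left mink.diff_right mink.minus_left mink.minus_right
  mink.scaleR_left mink.scaleR_right

lemma has_real_derivative_mink:
  assumes "(u has_vector_derivative u') (at s)" "(v has_vector_derivative v') (at s)"
  shows "((\<lambda>s. mink (u s) (v s)) has_real_derivative mink (u s) v' + mink u' (v s)) (at s)"
  using mink.has_vector_derivative[OF assms]
  by (simp add: has_real_derivative_iff_has_vector_derivative)

text \<open>Identities are known only on \<open>I\<close>; as \<open>I\<close> is open they hold
  near \<open>s\<close> and may be differentiated there.\<close>

lemma has_real_derivative_of_constant_on:
  assumes "open I" "s \<in> I" "\<And>t. t \<in> I \<Longrightarrow> f t = c" "(f has_real_derivative D) (at s)"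
  shows "D = 0"
proof -
  have "((\<lambda>_. c) has_real_derivative D) (at s)"
    by (rule has_field_derivative_transform_within_open[OF assms(4,1,2,3)])
  then show ?thesis
    using DERIV_const DERIV_unique by blast
qed

lemma mink_constant_on:
  assumes "open I" "s \<in> I" "\<And>t. t \<in> I \<Longrightarrow> mink (u t) (v t) = c"
    and "(u has_vector_derivative u') (at s)" "(v has_vector_derivative v') (at s)"
  shows "mink (u s) v' + mink u' (v s) = 0"
  by (rule has_real_derivative_of_constant_on[OF assms(1-3) has_real_derivative_mink[OF assms(4,5)]])

lemma open_intervalD:
  assumes "open_interval I"
  shows "open I" "convex I" "connected I" "I \<noteq> {}"
  using assms by (auto simp: open_interval_def is_interval_convex is_interval_connected)

lemma zero_derivative_constant_on:
  assumes I: "open_interval I" and d: "\<And>s. s \<in> I \<Longrightarrow> (f has_vector_derivative 0) (at s)"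
    and s: "s \<in> I" "t \<in> I"
  shows "f s = f t"
proof -
  obtain c where "\<And>x. x \<in> I \<Longrightarrow> f x = c"
    using has_vector_derivative_zero_constant[OF open_intervalD(2)[OF I], of f]
      has_vector_derivative_at_within[OF d] by metis
  then show ?thesis using s by simp
qed

lemma nderiv_0: "nderiv 0 \<alpha> = \<alpha>"
  by (simp add: nderiv_def)

lemma nderiv_Suc: "nderiv (Suc n) \<alpha> s = vector_derivative (nderiv n \<alpha>) (at s)"
  by (simp add: nderiv_def)

lemma nderiv_has_vector_derivative:
  assumes "smooth_curve I \<alpha>" "s \<in> I"
  shows "(nderiv n \<alpha> has_vector_derivative nderiv (Suc n) \<alpha> s) (at s)"
  using assms by (simp add: smooth_curve_def nderiv_Suc vector_derivative_works[symmetric])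

text \<open>\<open>nderiv\<close> differentiates total functions, while formulas are known only on
  an open set; near each of its points the two functions agree.\<close>

lemma nderiv_Suc_eqI:
  assumes "open S" "\<And>s. s \<in> S \<Longrightarrow> nderiv n \<alpha> s = F s"
    and "\<And>s. s \<in> S \<Longrightarrow> (F has_vector_derivative F' s) (at s)" and s: "s \<in> S"
  shows "(nderiv n \<alpha> has_vector_derivative F' s) (at s)" "nderiv (Suc n) \<alpha> s = F' s"
proof -
  show "(nderiv n \<alpha> has_vector_derivative F' s) (at s)"
    by (rule has_vector_derivative_transform_within_open[OF assms(3)[OF s] assms(1) s]) (simp add: assms(2))
  then show "nderiv (Suc n) \<alpha> s = F' s"
    by (simp add: nderiv_Suc vector_derivative_at)
qed

text \<open>The Gram matrix is triangular with respect to the antidiagonal: pairing with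
  \<open>n\<close> excludes \<open>n\<close> from the span of \<open>t\<close>, and pairing with
  \<open>t\<close> excludes \<open>p\<close> from the span of \<open>n\<close> and
  \<open>t\<close>.\<close>

lemma lin_indep3_of_gram:
  assumes "mink t t = 0" "mink t n = 0" "mink n n = 1" "mink t p = -1"
  shows "lin_indep3 t n p"
proof -
  have t: "t \<noteq> 0" using assms(4) by auto
  have n: "n - k *\<^sub>R t \<noteq> 0" for k
  proof
    assume "n - k *\<^sub>R t = 0"
    then have "mink (n - k *\<^sub>R t) n = 0" by simp
    then show False using assms by (simp add: mink_linear_simps)
  qed
  have p: "p - k *\<^sub>R n - j *\<^sub>R t \<noteq> 0" for k j
  proof
    assume "p - k *\<^sub>R n - j *\<^sub>R t = 0"
    then have "mink t (p - k *\<^sub>R n - j *\<^sub>R t) = 0" by simp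
    then show False using assms by (simp add: mink_linear_simps)
  qed
  have "n \<notin> span {t}" "p \<notin> span {n, t}"
    using n p by (auto simp: span_breakdown_eq)
  moreover have "n \<noteq> t" "p \<noteq> t" "p \<noteq> n"
    using assms by auto
  ultimately have "independent {p, n, t}"
    using t by (auto simp: independent_insert)
  moreover have "{p, n, t} = {t, n, p}" by auto
  ultimately show ?thesis
    using \<open>n \<noteq> t\<close> \<open>p \<noteq> t\<close> \<open>p \<noteq> n\<close> by (auto simp: lin_indep3_def)
qed

lemma lin_indep3_expand:
  assumes "lin_indep3 t n p"
  obtains x y z where "v = x *\<^sub>R t + y *\<^sub>R n + z *\<^sub>R p"
proof -
  have "card {t, n, p} = 3" "independent {t, n, p}"
    using assms by (auto simp: lin_indep3_def)
  then have "UNIV \<subseteq> span {t, n, p}"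
    by (intro card_ge_dim_independent) auto
  then have "v \<in> span {t, n, p}" by auto
  then obtain x y z where "v - x *\<^sub>R t - y *\<^sub>R n - z *\<^sub>R p = 0"
    by (auto simp: span_breakdown_eq)
  then have "v = x *\<^sub>R t + y *\<^sub>R n + z *\<^sub>R p"
    by (simp add: algebra_simps)
  then show ?thesis by (rule that)
qed

section \<open>The Cartan frame\<close>

text \<open>Since g(T, T) = 0 and the product of T with the third derivative is -1, adding
  \<open>torsion\<close> times T makes the third derivative null. The frame T, N, B then has a
  constant Gram matrix.\<close>

definition binormal :: "(real \<Rightarrow> real^3) \<Rightarrow> real \<Rightarrow> real^3" where
  "binormal \<alpha> s = nderiv 3 \<alpha> s + torsion \<alpha> s *\<^sub>R nderiv 1 \<alpha> s"

text \<open>Linear independence is derived inside the locale from the metric conditions, so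
  \<open>null_curveI\<close> can serve to verify \<open>null_curve\<close> for explicit
  curves.\<close>

locale null_curve_frame =
  fixes I :: "real set" and \<alpha> :: "real \<Rightarrow> real^3"
  assumes I: "open_interval I" and smooth: "smooth_curve I \<alpha>"
    and TT: "\<And>s. s \<in> I \<Longrightarrow> mink (nderiv 1 \<alpha> s) (nderiv 1 \<alpha> s) = 0"
    and NN: "\<And>s. s \<in> I \<Longrightarrow> mink (nderiv 2 \<alpha> s) (nderiv 2 \<alpha> s) = 1"
begin

lemma deriv_T: "s \<in> I \<Longrightarrow> (nderiv 1 \<alpha> has_vector_derivative nderiv 2 \<alpha> s) (at s)"
  using nderiv_has_vector_derivative[OF smooth, of s 1] by simp

lemma deriv_N: "s \<in> I \<Longrightarrow> (nderiv 2 \<alpha> has_vector_derivative nderiv 3 \<alpha> s) (at s)"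
  using nderiv_has_vector_derivative[OF smooth, of s 2] by simp

lemma deriv_P: "s \<in> I \<Longrightarrow> (nderiv 3 \<alpha> has_vector_derivative nderiv 4 \<alpha> s) (at s)"
  using nderiv_has_vector_derivative[OF smooth, of s 3] by simp

lemma PP: "mink (nderiv 3 \<alpha> s) (nderiv 3 \<alpha> s) = 2 * torsion \<alpha> s"
  by (simp add: torsion_def)

lemmas mink_constant = mink_constant_on[OF open_intervalD(1)[OF I]]

text \<open>With P and Q for the third and fourth derivatives, each relation is the derivative of an
  earlier one: TT gives TN, NN gives NP, TN gives TP, TP gives TQ, NP gives NQ.\<close>

lemma TN:
  assumes s: "s \<in> I"
  shows "mink (nderiv 1 \<alpha> s) (nderiv 2 \<alpha> s) = 0"
  using mink_constant[OF s TT deriv_T[OF s] deriv_T[OF s]] by (simp add: mink_commute)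

lemma NP:
  assumes s: "s \<in> I"
  shows "mink (nderiv 2 \<alpha> s) (nderiv 3 \<alpha> s) = 0"
  using mink_constant[OF s NN deriv_N[OF s] deriv_N[OF s]] by (simp add: mink_commute)

lemma TP:
  assumes s: "s \<in> I"
  shows "mink (nderiv 1 \<alpha> s) (nderiv 3 \<alpha> s) = -1"
  using mink_constant[OF s TN deriv_T[OF s] deriv_N[OF s]] NN[OF s] by simp

lemma TQ:
  assumes s: "s \<in> I"
  shows "mink (nderiv 1 \<alpha> s) (nderiv 4 \<alpha> s) = 0"
  using mink_constant[OF s TP deriv_T[OF s] deriv_P[OF s]] NP[OF s] by simp

lemma NQ:
  assumes s: "s \<in> I"
  shows "mink (nderiv 2 \<alpha> s) (nderiv 4 \<alpha> s) = - 2 * torsion \<alpha> s"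
  using mink_constant[OF s NP deriv_N[OF s] deriv_P[OF s]] PP[of s] by simp

lemma lin_indep3_derivatives:
  "s \<in> I \<Longrightarrow> lin_indep3 (nderiv 1 \<alpha> s) (nderiv 2 \<alpha> s) (nderiv 3 \<alpha> s)"
  by (intro lin_indep3_of_gram TT TN NN TP)

lemma null_curveI: "null_curve I \<alpha>"
  using I smooth TT NN lin_indep3_derivatives by (simp add: null_curve_def)

lemma TB: "s \<in> I \<Longrightarrow> mink (nderiv 1 \<alpha> s) (binormal \<alpha> s) = -1"
  by (simp add: binormal_def mink_linear_simps TP TT)

lemma NB: "s \<in> I \<Longrightarrow> mink (nderiv 2 \<alpha> s) (binormal \<alpha> s) = 0"
  by (simp add: binormal_def mink_linear_simps NP TN mink_commute[of "nderiv 2 \<alpha> s" "nderiv 1 \<alpha> s"])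

lemma BB: "s \<in> I \<Longrightarrow> mink (binormal \<alpha> s) (binormal \<alpha> s) = 0"
  by (simp add: binormal_def mink_linear_simps TP TT PP mink_commute[of "nderiv 3 \<alpha> s" "nderiv 1 \<alpha> s"])

text \<open>Independence of the first three derivatives provides coefficients, and pairing with the
  frame reads them off. T and B are null with product -1, so each one detects the coefficient of the
  other, with a sign.\<close>

lemma frame_expansion:
  assumes s: "s \<in> I"
  shows "v = (- mink v (binormal \<alpha> s)) *\<^sub>R nderiv 1 \<alpha> s + mink v (nderiv 2 \<alpha> s) *\<^sub>R nderiv 2 \<alpha> s
    - mink v (nderiv 1 \<alpha> s) *\<^sub>R binormal \<alpha> s"
proof -
  obtain x y z where "v = x *\<^sub>R nderiv 1 \<alpha> s + y *\<^sub>R nderiv 2 \<alpha> s + z *\<^sub>R nderiv 3 \<alpha> s"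
    by (rule lin_indep3_expand[OF lin_indep3_derivatives[OF s]])
  also have "\<dots> = (x - z * torsion \<alpha> s) *\<^sub>R nderiv 1 \<alpha> s + y *\<^sub>R nderiv 2 \<alpha> s + z *\<^sub>R binormal \<alpha> s"
    by (simp add: binormal_def algebra_simps)
  finally have v: "v = \<dots>" .
  have "mink v (binormal \<alpha> s) = - (x - z * torsion \<alpha> s)" "mink v (nderiv 2 \<alpha> s) = y"
    "mink v (nderiv 1 \<alpha> s) = - z"
    using s by (simp_all add: v mink_linear_simps TT TN NN TB NB BB
        mink_commute[of "nderiv 2 \<alpha> s" "nderiv 1 \<alpha> s"]
        mink_commute[of "binormal \<alpha> s" "nderiv 1 \<alpha> s"]
        mink_commute[of "binormal \<alpha> s" "nderiv 2 \<alpha> s"])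
  then show ?thesis by (simp add: v)
qed

lemma deriv_N':
  "s \<in> I \<Longrightarrow> (nderiv 2 \<alpha> has_vector_derivative binormal \<alpha> s - torsion \<alpha> s *\<^sub>R nderiv 1 \<alpha> s) (at s)"
  using deriv_N[of s] by (simp add: binormal_def)

lemma deriv_B:
  assumes s: "s \<in> I"
  shows "(binormal \<alpha> has_vector_derivative - torsion \<alpha> s *\<^sub>R nderiv 2 \<alpha> s) (at s)"
proof -
  let ?\<tau>' = "mink (nderiv 3 \<alpha> s) (nderiv 4 \<alpha> s)"
  have "(torsion \<alpha> has_real_derivative ?\<tau>') (at s)"
    unfolding torsion_def[abs_def]
    by (rule derivative_eq_intros has_real_derivative_mink deriv_P s refl)+
       (simp add: mink_commute)
  then have "(binormal \<alpha> has_vector_derivative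
      nderiv 4 \<alpha> s + (torsion \<alpha> s *\<^sub>R nderiv 2 \<alpha> s + ?\<tau>' *\<^sub>R nderiv 1 \<alpha> s)) (at s)"
    unfolding binormal_def[abs_def]
    by (intro has_vector_derivative_add deriv_P has_vector_derivative_scaleR deriv_T s)
  \<comment> \<open>Because of \<open>TQ\<close> there is no B term. The T coefficient is exactly
    what cancels the derivative of \<open>torsion\<close> in the product rule.\<close>
  moreover have "nderiv 4 \<alpha> s = (- ?\<tau>') *\<^sub>R nderiv 1 \<alpha> s + (- 2 * torsion \<alpha> s) *\<^sub>R nderiv 2 \<alpha> s"
    using frame_expansion[OF s, of "nderiv 4 \<alpha> s"] s
    by (simp add: TQ NQ binormal_def mink_linear_simps mink_commute[of "nderiv 4 \<alpha> s"])
  then have "nderiv 4 \<alpha> s + (torsion \<alpha> s *\<^sub>R nderiv 2 \<alpha> s + ?\<tau>' *\<^sub>R nderiv 1 \<alpha> s)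
      = - torsion \<alpha> s *\<^sub>R nderiv 2 \<alpha> s"
    by (simp add: vec_eq_iff algebra_simps)
  ultimately show ?thesis by simp
qed

end

lemma null_curveD:
  assumes "null_curve I \<alpha>"
  shows "open_interval I" "smooth_curve I \<alpha>"
    "\<And>s. s \<in> I \<Longrightarrow> mink (nderiv 1 \<alpha> s) (nderiv 1 \<alpha> s) = 0"
    "\<And>s. s \<in> I \<Longrightarrow> mink (nderiv 2 \<alpha> s) (nderiv 2 \<alpha> s) = 1"
  using assms by (auto simp: null_curve_def)

lemma null_curve_frame_of: "null_curve I \<alpha> \<Longrightarrow> null_curve_frame I \<alpha>"
  by (simp add: null_curve_frame_def null_curve_def)

text \<open>Restated outside the locale because the next theorem uses the frames of two curves at
  once.\<close>

lemmas null_frame_expansion = null_curve_frame.frame_expansion[OF null_curve_frame_of]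

lemmas null_frame_derivs =
  null_curve_frame.deriv_T[OF null_curve_frame_of]
  null_curve_frame.deriv_N'[OF null_curve_frame_of]
  null_curve_frame.deriv_B[OF null_curve_frame_of]

lemmas null_frame_gram =
  null_curveD(3,4)
  null_curve_frame.TN[OF null_curve_frame_of] null_curve_frame.TB[OF null_curve_frame_of]
  null_curve_frame.NB[OF null_curve_frame_of] null_curve_frame.BB[OF null_curve_frame_of]

section \<open>Congruence of null curves with equal torsion\<close>

theorem torsion_determines_null_curve:
  assumes \<alpha>: "null_curve I \<alpha>" and \<beta>: "null_curve I \<beta>"
    and \<tau>: "\<And>s. s \<in> I \<Longrightarrow> torsion \<alpha> s = torsion \<beta> s"
  shows "\<exists>\<Phi>. mink_isometry \<Phi> \<and> (\<forall>s\<in>I. \<alpha> s = \<Phi> (\<beta> s))"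
proof -
  have I: "open_interval I" using \<alpha> by (rule null_curveD)
  obtain s0 where s0: "s0 \<in> I" using open_intervalD(4)[OF I] by auto
  \<comment> \<open>The frame expansion of \<open>v\<close> along \<open>\<beta>\<close>, with the
    frame vectors of \<open>\<beta>\<close> replaced by those of \<open>\<alpha>\<close>.\<close>
  define M where "M s v = (- mink v (binormal \<beta> s)) *\<^sub>R nderiv 1 \<alpha> s
    + mink v (nderiv 2 \<beta> s) *\<^sub>R nderiv 2 \<alpha> s - mink v (nderiv 1 \<beta> s) *\<^sub>R binormal \<alpha> s" for s v
  have M: "M s v = M s0 v" if "s \<in> I" for s v
  proof (rule zero_derivative_constant_on[OF I _ that s0])
    fix s assume s: "s \<in> I"
    have mink_deriv: "((\<lambda>s. mink v (w s)) has_real_derivative mink v w') (at s)"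
      if "(w has_vector_derivative w') (at s)" for w w'
      using has_real_derivative_mink[OF has_vector_derivative_const that] by simp
    \<comment> \<open>Both frames satisfy the same linear equations, as the torsions agree, so the
      terms of the derivative cancel in pairs.\<close>
    show "((\<lambda>s. M s v) has_vector_derivative 0) (at s)"
      unfolding M_def
      by (rule has_vector_derivative_eq_rhs,
          (rule has_vector_derivative_add has_vector_derivative_diff has_vector_derivative_scaleR
            DERIV_minus mink_deriv null_frame_derivs[OF \<alpha> s] null_frame_derivs[OF \<beta> s])+)
        (simp add: \<tau>[OF s] mink_linear_simps algebra_simps)
  qed
  have lin: "linear (M s0)"
    by (simp add: linear_iff M_def mink_linear_simps algebra_simps)
  \<comment> \<open>The two frames have the same Gram matrix, so both products are the same
    expression in the frame coordinates of \<open>u\<close> and \<open>v\<close>.\<close>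
  have isom: "mink (M s0 u) (M s0 v) = mink u v" for u v
  proof -
    note gram\<alpha> = null_frame_gram[OF \<alpha> s0]
    have "mink u v = - mink u (binormal \<beta> s0) * mink (nderiv 1 \<beta> s0) v
        + mink u (nderiv 2 \<beta> s0) * mink (nderiv 2 \<beta> s0) v
        - mink u (nderiv 1 \<beta> s0) * mink (binormal \<beta> s0) v"
      by (subst null_frame_expansion[OF \<beta> s0, of u]) (simp add: mink_linear_simps)
    also have "\<dots> = mink (M s0 u) (M s0 v)"
      by (simp add: M_def mink_linear_simps gram\<alpha> mink_commute[of _ v]
        mink_commute[of "nderiv 2 \<alpha> s0" "nderiv 1 \<alpha> s0"]
        mink_commute[of "binormal \<alpha> s0" "nderiv 1 \<alpha> s0"]
        mink_commute[of "binormal \<alpha> s0" "nderiv 2 \<alpha> s0"])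
    finally show ?thesis ..
  qed
  \<comment> \<open>By its formula \<open>M s\<close> sends the tangent of \<open>\<beta>\<close> at
    \<open>s\<close> to that of \<open>\<alpha>\<close>; constancy of \<open>M\<close> makes the
    single map \<open>M s0\<close> do so at every \<open>s\<close>.\<close>
  have T: "M s0 (nderiv 1 \<beta> s) = nderiv 1 \<alpha> s" if s: "s \<in> I" for s
    using M[OF s, of "nderiv 1 \<beta> s"] by (simp add: M_def null_frame_gram[OF \<beta> s])
  define p where "p = \<alpha> s0 - M s0 (\<beta> s0)"
  have "\<alpha> s - M s0 (\<beta> s) = p" if "s \<in> I" for s
    unfolding p_def
  proof (rule zero_derivative_constant_on[OF I _ that s0])
    fix s assume s: "s \<in> I"
    have tangent: "(\<gamma> has_vector_derivative nderiv 1 \<gamma> s) (at s)" if "null_curve I \<gamma>" for \<gamma>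
      using nderiv_has_vector_derivative[OF null_curveD(2)[OF that] s, of 0] by (simp add: nderiv_0 One_nat_def)
    have "((\<lambda>s. \<alpha> s - M s0 (\<beta> s)) has_vector_derivative
        nderiv 1 \<alpha> s - M s0 (nderiv 1 \<beta> s)) (at s)"
      by (intro has_vector_derivative_diff tangent \<alpha> \<beta>
          bounded_linear.has_vector_derivative[OF lin[unfolded linear_conv_bounded_linear]])
    then show "((\<lambda>s. \<alpha> s - M s0 (\<beta> s)) has_vector_derivative 0) (at s)"
      by (simp add: T s)
  qed
  then have "\<forall>s\<in>I. \<alpha> s = M s0 (\<beta> s) + p"
    by (metis add.commute diff_add_cancel)
  moreover have "mink_isometry (\<lambda>x. M s0 x + p)"
    using lin isom by (auto simp: mink_isometry_def)
  ultimately show ?thesis by auto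
qed

section \<open>Slant helices and the torsion\<close>

lemma slant_not_general_imp_torsion:
  assumes slant: "null_slant_helix I \<alpha>" and not_general: "\<not> null_general_helix I \<alpha>"
  shows "\<exists>a \<epsilon> d. a \<noteq> 0 \<and> (\<epsilon> = 1 \<or> \<epsilon> = -1) \<and>
    (\<forall>s\<in>I. \<epsilon> * s + d > 0 \<and> torsion \<alpha> s = a / (2 * (\<epsilon> * s + d)^2))"
proof -
  have \<alpha>: "null_curve I \<alpha>" using slant by (simp add: null_slant_helix_def)
  obtain V c where V: "V \<noteq> 0" and c: "\<And>s. s \<in> I \<Longrightarrow> mink (nderiv 2 \<alpha> s) V = c"
    using slant by (auto simp: null_slant_helix_def)
  have I: "open_interval I" using \<alpha> by (rule null_curveD)
  obtain s0 where s0: "s0 \<in> I" using open_intervalD(4)[OF I] by auto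
  have mink_V: "((\<lambda>s. mink (w s) V) has_real_derivative mink w' V) (at s)"
    if "(w has_vector_derivative w') (at s)" for w w' s
    using has_real_derivative_mink[OF that has_vector_derivative_const] by simp
  let ?f = "\<lambda>s. mink (nderiv 1 \<alpha> s) V"
  let ?h = "\<lambda>s. mink (binormal \<alpha> s) V"
  have df: "(?f has_real_derivative c) (at s)" if "s \<in> I" for s
    using mink_V[OF null_frame_derivs(1)[OF \<alpha> that]] c[OF that] by simp
  have dh: "(?h has_real_derivative - torsion \<alpha> s * c) (at s)" if "s \<in> I" for s
    using mink_V[OF null_frame_derivs(3)[OF \<alpha> that]] c[OF that] by (simp add: mink_linear_simps)
  \<comment> \<open>Differentiating g(N, V) = c gives g(N', V) = 0, where N' is B minus
    \<open>torsion\<close> times T.\<close>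
  have h: "?h s = torsion \<alpha> s * ?f s" if "s \<in> I" for s
    using has_real_derivative_of_constant_on[OF open_intervalD(1)[OF I] that c
        mink_V[OF null_frame_derivs(2)[OF \<alpha> that]]]
    by (simp add: mink_linear_simps)
  define d0 where "d0 = ?f s0 - c * s0"
  have f: "?f s = c * s + d0" if "s \<in> I" for s
  proof -
    have "?f s - c * s = ?f s0 - c * s0"
      by (rule zero_derivative_constant_on[OF I _ that s0],
          unfold has_real_derivative_iff_has_vector_derivative[symmetric])
        (auto intro!: derivative_eq_intros df)
    then show ?thesis by (simp add: d0_def)
  qed
  \<comment> \<open>Otherwise g(T, V) would be constant and \<open>V\<close> would be the axis of a
    general helix.\<close>
  have "c \<noteq> 0"
    using not_general \<alpha> V f by (auto simp: null_general_helix_def)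
  define k where "k = ?h s0 * ?f s0"
  have k: "torsion \<alpha> s * (c * s + d0)^2 = k" if s: "s \<in> I" for s
  proof -
    have "?h s * ?f s = ?h s0 * ?f s0"
      by (rule zero_derivative_constant_on[OF I _ s s0],
          unfold has_real_derivative_iff_has_vector_derivative[symmetric])
        (rule derivative_eq_intros df dh refl | assumption | simp add: h)+
    then show ?thesis by (simp add: k_def h f s power2_eq_square)
  qed
  \<comment> \<open>If \<open>k\<close> vanishes then so does \<open>?h\<close>, and its derivative
    forces zero torsion even at a possible zero of \<open>?f\<close>. Then B is constant, and g(T,
    B) = -1 makes it the axis of a general helix.\<close>
  have "k \<noteq> 0"
  proof
    assume "k = 0"
    then have h0: "?h s = 0" if "s \<in> I" for s
      using k[OF that] that by (auto simp: h f)
    have "- torsion \<alpha> s * c = 0" if "s \<in> I" for s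
      using has_real_derivative_of_constant_on[OF open_intervalD(1)[OF I] that h0 dh[OF that]] .
    then have \<tau>0: "torsion \<alpha> s = 0" if "s \<in> I" for s
      using that \<open>c \<noteq> 0\<close> by auto
    have "binormal \<alpha> s = binormal \<alpha> s0" if "s \<in> I" for s
      using null_frame_derivs(3)[OF \<alpha>] \<tau>0
      by (intro zero_derivative_constant_on[OF I _ that s0]) fastforce
    then have "mink (nderiv 1 \<alpha> s) (binormal \<alpha> s0) = -1" if "s \<in> I" for s
      using null_frame_gram(4)[OF \<alpha> that] that by simp
    moreover from this have "binormal \<alpha> s0 \<noteq> 0"
      using s0 by force
    ultimately show False
      using not_general \<alpha> by (auto simp: null_general_helix_def)
  qed
  define r where "r = d0 / c"
  have r: "c * s + d0 = c * (s + r)" for s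
    using \<open>c \<noteq> 0\<close> by (simp add: r_def field_simps)
  \<comment> \<open>The affine function \<open>?f\<close> vanishes at \<open>- r\<close>, where
    \<open>k\<close> would have to be 0.\<close>
  have "- r \<notin> I"
    using k[of "- r", unfolded r] \<open>k \<noteq> 0\<close> by auto
  have \<tau>: "torsion \<alpha> s = (2 * k / c^2) / (2 * (s + r)^2)" if "s \<in> I" for s
  proof -
    have "s + r \<noteq> 0" using that \<open>- r \<notin> I\<close> by (metis add_eq_0_iff2)
    then show ?thesis
      using k[OF that, unfolded r] \<open>c \<noteq> 0\<close>
      by (simp add: power_mult_distrib eq_divide_eq divide_eq_eq mult_ac)
  qed
  \<comment> \<open>An interval missing \<open>- r\<close> lies on one side of it; the side decides
    the sign that makes the new parameter positive.\<close>
  have "(\<forall>s\<in>I. - r < s) \<or> (\<forall>s\<in>I. s < - r)"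
    using connectedD_interval[OF open_intervalD(3)[OF I], of _ _ "- r"] \<open>- r \<notin> I\<close>
    by (metis linorder_le_cases order_le_less)
  then show ?thesis
  proof
    assume pos: "\<forall>s\<in>I. - r < s"
    have "1 * s + r > 0 \<and> torsion \<alpha> s = (2 * k / c^2) / (2 * (1 * s + r)^2)" if "s \<in> I" for s
      using bspec[OF pos that] \<tau>[OF that] by simp
    then show ?thesis
      using \<open>k \<noteq> 0\<close> \<open>c \<noteq> 0\<close>
      by (intro exI[of _ "2 * k / c^2"] exI[of _ 1] exI[of _ r]) simp
  next
    assume neg: "\<forall>s\<in>I. s < - r"
    have "-1 * s + - r > 0 \<and> torsion \<alpha> s = (2 * k / c^2) / (2 * (-1 * s + - r)^2)" if "s \<in> I" for s
    proof -
      have "(-1 * s + - r)^2 = (s + r)^2"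
        by (simp add: power2_eq_square algebra_simps)
      then show ?thesis
        using bspec[OF neg that] \<tau>[OF that] by simp
    qed
    then show ?thesis
      using \<open>k \<noteq> 0\<close> \<open>c \<noteq> 0\<close>
      by (intro exI[of _ "2 * k / c^2"] exI[of _ "-1"] exI[of _ "- r"]) simp
  qed
qed

lemma torsion_imp_slant_not_general:
  assumes \<alpha>: "null_curve I \<alpha>" and "a \<noteq> 0" "\<epsilon> \<noteq> 0"
    and \<tau>: "\<And>s. s \<in> I \<Longrightarrow> \<epsilon> * s + d \<noteq> 0 \<and> torsion \<alpha> s = a / (2 * (\<epsilon> * s + d)^2)"
  shows "null_slant_helix I \<alpha> \<and> \<not> null_general_helix I \<alpha>"
proof -
  have I: "open_interval I" using \<alpha> by (rule null_curveD)
  note openI = open_intervalD(1)[OF I]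
  obtain s0 where s0: "s0 \<in> I" using open_intervalD(4)[OF I] by auto
  \<comment> \<open>The frame expansion of an axis V with g(T, V) = f, g(N, V) = f' and g(B, V) = a
    / (2 f), where f is the affine function \<open>\<epsilon> * s + d\<close>.\<close>
  define W where "W s = (- (a / (2 * (\<epsilon> * s + d)))) *\<^sub>R nderiv 1 \<alpha> s + \<epsilon> *\<^sub>R nderiv 2 \<alpha> s
    - (\<epsilon> * s + d) *\<^sub>R binormal \<alpha> s" for s
  have affine: "((\<lambda>s. \<epsilon> * s + d) has_real_derivative \<epsilon>) (at s)" for s
    by (auto intro!: derivative_eq_intros)
  have W: "W s = W s0" if "s \<in> I" for s
  proof (rule zero_derivative_constant_on[OF I _ that s0])
    fix s assume s: "s \<in> I"
    have nz: "\<epsilon> * s + d \<noteq> 0" using \<tau>[OF s] by simp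
    have "((\<lambda>g. - (a / (2 * g))) has_real_derivative a / (2 * g^2)) (at g)" if "g \<noteq> 0" for g
      using that by (auto intro!: derivative_eq_intros simp: field_simps power2_eq_square)
    from DERIV_chain2[OF this[OF nz] affine]
    have 1: "((\<lambda>s. - (a / (2 * (\<epsilon> * s + d)))) has_real_derivative \<epsilon> * torsion \<alpha> s) (at s)"
      using \<tau>[OF s] by (simp add: mult.commute)
    have 2: "(\<epsilon> * s + d) * torsion \<alpha> s = a / (2 * (\<epsilon> * s + d))"
      using \<tau>[OF s] by (simp add: power2_eq_square)
    have "(W has_vector_derivative
        ((- (a / (2 * (\<epsilon> * s + d)))) *\<^sub>R nderiv 2 \<alpha> s + (\<epsilon> * torsion \<alpha> s) *\<^sub>R nderiv 1 \<alpha> s)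
        + (\<epsilon> *\<^sub>R (binormal \<alpha> s - torsion \<alpha> s *\<^sub>R nderiv 1 \<alpha> s) + 0 *\<^sub>R nderiv 2 \<alpha> s)
        - ((\<epsilon> * s + d) *\<^sub>R (- torsion \<alpha> s *\<^sub>R nderiv 2 \<alpha> s) + \<epsilon> *\<^sub>R binormal \<alpha> s)) (at s)"
      unfolding W_def[abs_def]
      by (intro has_vector_derivative_add has_vector_derivative_diff has_vector_derivative_scaleR
          null_frame_derivs[OF \<alpha> s] 1 affine DERIV_const)
    also have "((- (a / (2 * (\<epsilon> * s + d)))) *\<^sub>R nderiv 2 \<alpha> s + (\<epsilon> * torsion \<alpha> s) *\<^sub>R nderiv 1 \<alpha> s)
        + (\<epsilon> *\<^sub>R (binormal \<alpha> s - torsion \<alpha> s *\<^sub>R nderiv 1 \<alpha> s) + 0 *\<^sub>R nderiv 2 \<alpha> s)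
        - ((\<epsilon> * s + d) *\<^sub>R (- torsion \<alpha> s *\<^sub>R nderiv 2 \<alpha> s) + \<epsilon> *\<^sub>R binormal \<alpha> s) = 0"
      unfolding 2[symmetric] by (simp add: algebra_simps)
    finally show "(W has_vector_derivative 0) (at s)" .
  qed
  have N: "mink (nderiv 2 \<alpha> s) (W s0) = \<epsilon>" if s: "s \<in> I" for s
    using null_frame_gram[OF \<alpha> s]
    unfolding W[OF s, symmetric]
    by (simp add: W_def mink_linear_simps
        mink_commute[of "nderiv 2 \<alpha> s" "nderiv 1 \<alpha> s"])
  have "W s0 \<noteq> 0" using N[OF s0] \<open>\<epsilon> \<noteq> 0\<close> by auto
  then have "null_slant_helix I \<alpha>"
    using \<alpha> N by (auto simp: null_slant_helix_def)
  \<comment> \<open>For an axis \<open>V\<close> with g(T, V) = c, N is orthogonal to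
    \<open>V\<close>, so g(B, V), which is c times \<open>torsion\<close>, is constant. The
    derivative of \<open>torsion\<close> is non-zero at \<open>s0\<close>, so c = 0 and all frame
    coordinates of \<open>V\<close> vanish.\<close>
  moreover have False if general: "null_general_helix I \<alpha>"
  proof -
    obtain V c where V: "V \<noteq> 0" and c: "\<And>s. s \<in> I \<Longrightarrow> mink (nderiv 1 \<alpha> s) V = c"
      using general by (auto simp: null_general_helix_def)
    have mink_V: "((\<lambda>s. mink (w s) V) has_real_derivative mink w' V) (at s)"
      if "(w has_vector_derivative w') (at s)" for w w' s
      using has_real_derivative_mink[OF that has_vector_derivative_const] by simp
    have N0: "mink (nderiv 2 \<alpha> s) V = 0" if "s \<in> I" for s
      using has_real_derivative_of_constant_on[OF openI that c mink_V[OF null_frame_derivs(1)[OF \<alpha> that]]] .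
    have B: "mink (binormal \<alpha> s) V = torsion \<alpha> s * c" if "s \<in> I" for s
      using has_real_derivative_of_constant_on[OF openI that N0 mink_V[OF null_frame_derivs(2)[OF \<alpha> that]]]
        c[OF that] by (simp add: mink_linear_simps)
    have "c * torsion \<alpha> s = c * torsion \<alpha> s0" if "s \<in> I" for s
    proof -
      have "mink (binormal \<alpha> s) V = mink (binormal \<alpha> s0) V"
      proof (rule zero_derivative_constant_on[OF I _ that s0])
        fix s assume s: "s \<in> I"
        show "((\<lambda>s. mink (binormal \<alpha> s) V) has_vector_derivative 0) (at s)"
          using mink_V[OF null_frame_derivs(3)[OF \<alpha> s]] N0[OF s]
          by (simp add: mink_linear_simps has_real_derivative_iff_has_vector_derivative[symmetric])
      qed
      then show ?thesis using B that s0 by (simp add: mult.commute)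
    qed
    moreover have "(torsion \<alpha> has_real_derivative - (a * \<epsilon> / (\<epsilon> * s0 + d)^3)) (at s0)"
    proof (rule has_field_derivative_transform_within_open[OF _ openI s0])
      have "((\<lambda>g. a / (2 * g^2)) has_real_derivative - (a / g^3)) (at g)" if "g \<noteq> 0" for g
        using that
        by (auto intro!: derivative_eq_intros simp: field_simps power2_eq_square power3_eq_cube)
      from DERIV_chain2[OF this affine, of s0]
      show "((\<lambda>s. a / (2 * (\<epsilon> * s + d)^2)) has_real_derivative - (a * \<epsilon> / (\<epsilon> * s0 + d)^3)) (at s0)"
        using \<tau>[OF s0] by simp
    qed (simp add: \<tau>)
    ultimately have "c * - (a * \<epsilon> / (\<epsilon> * s0 + d)^3) = 0"
      by (intro has_real_derivative_of_constant_on[OF openI s0, of "\<lambda>s. c * torsion \<alpha> s" "c * torsion \<alpha> s0"] DERIV_cmult)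
    then have "c = 0"
      using \<tau>[OF s0] \<open>a \<noteq> 0\<close> \<open>\<epsilon> \<noteq> 0\<close> by auto
    then have "V = 0"
      using null_frame_expansion[OF \<alpha> s0, of V] c[OF s0] N0[OF s0] B[OF s0]
      by (simp add: mink_commute[of V])
    then show False using V by simp
  qed
  ultimately show ?thesis by blast
qed

section \<open>Changes of parameter and isometries\<close>

text \<open>Existence and value of the derivative are proved together: the value drives the
  induction, and existence yields smoothness of \<open>\<alpha>\<close>.\<close>

lemma nderiv_affine_comp:
  assumes "open I" and A: "linear A" and \<beta>: "smooth_curve J \<beta>"
    and J: "\<And>s. s \<in> I \<Longrightarrow> \<epsilon> * s + d \<in> J"
    and \<alpha>: "\<And>s. s \<in> I \<Longrightarrow> \<alpha> s = A (\<beta> (\<epsilon> * s + d)) + p"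
  shows "s \<in> I \<Longrightarrow> (nderiv n \<alpha> has_vector_derivative \<epsilon> ^ Suc n *\<^sub>R A (nderiv (Suc n) \<beta> (\<epsilon> * s + d))) (at s)
    \<and> nderiv (Suc n) \<alpha> s = \<epsilon> ^ Suc n *\<^sub>R A (nderiv (Suc n) \<beta> (\<epsilon> * s + d))"
proof (induction n arbitrary: s)
  \<comment> \<open>One differentiation with a free factor \<open>k\<close> and constant
    \<open>q\<close>: the base case takes 1 and \<open>p\<close>, later steps take a power of
    \<open>\<epsilon>\<close> and 0, since the translation disappears after one derivative.\<close>
  have d: "((\<lambda>s. k *\<^sub>R A (nderiv n \<beta> (\<epsilon> * s + d)) + q) has_vector_derivative
      (\<epsilon> * k) *\<^sub>R A (nderiv (Suc n) \<beta> (\<epsilon> * s + d))) (at s)" if "s \<in> I" for k n q s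
  proof -
    have aff: "((\<lambda>s. \<epsilon> * s + d) has_vector_derivative \<epsilon>) (at s)"
      unfolding has_real_derivative_iff_has_vector_derivative[symmetric]
      by (auto intro!: derivative_eq_intros)
    have "(nderiv n \<beta> \<circ> (\<lambda>s. \<epsilon> * s + d) has_vector_derivative
        \<epsilon> *\<^sub>R nderiv (Suc n) \<beta> (\<epsilon> * s + d)) (at s)"
      by (rule vector_diff_chain_at[OF aff nderiv_has_vector_derivative[OF \<beta> J[OF that]]])
    then have "((\<lambda>s. k *\<^sub>R A ((nderiv n \<beta> \<circ> (\<lambda>s. \<epsilon> * s + d)) s)) has_vector_derivative
        k *\<^sub>R A (\<epsilon> *\<^sub>R nderiv (Suc n) \<beta> (\<epsilon> * s + d))) (at s)"
      using A by (intro bounded_linear.has_vector_derivative[OF bounded_linear_scaleR_right]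
          bounded_linear.has_vector_derivative[where f = A]) (simp_all only: linear_conv_bounded_linear)
    then have "((\<lambda>s. k *\<^sub>R A (nderiv n \<beta> (\<epsilon> * s + d)) + q) has_vector_derivative
        k *\<^sub>R A (\<epsilon> *\<^sub>R nderiv (Suc n) \<beta> (\<epsilon> * s + d)) + 0) (at s)"
      by (intro has_vector_derivative_add has_vector_derivative_const) (simp only: o_def)
    then show ?thesis by (simp add: linear_cmul[OF A] mult.commute)
  qed
  {
    case 0
    then show ?case
      using nderiv_Suc_eqI[OF \<open>open I\<close> _ d[of _ 1 0 p], of 0 \<alpha>] \<alpha> by (simp add: nderiv_0)
  next
    case (Suc n)
    then show ?case
      using nderiv_Suc_eqI[OF \<open>open I\<close> _ d[of _ "\<epsilon> ^ Suc n" "Suc n" 0], of "Suc n" \<alpha>] by simp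
  }
qed

text \<open>All the metric data are squares of derivatives, so the powers of
  \<open>\<epsilon>\<close> enter squared and disappear; this is why reversing the parameter leaves
  the torsion unchanged.\<close>

lemma null_curve_affine_comp:
  assumes I: "open_interval I" and A: "linear A" and isom: "\<And>u v. mink (A u) (A v) = mink u v"
    and \<epsilon>: "\<epsilon> = 1 \<or> \<epsilon> = -1" and \<beta>: "null_curve J \<beta>" and J: "\<And>s. s \<in> I \<Longrightarrow> \<epsilon> * s + d \<in> J"
    and \<alpha>: "\<And>s. s \<in> I \<Longrightarrow> \<alpha> s = A (\<beta> (\<epsilon> * s + d)) + p"
  shows "null_curve I \<alpha>" and "s \<in> I \<Longrightarrow> torsion \<alpha> s = torsion \<beta> (\<epsilon> * s + d)"
proof -
  note * = nderiv_affine_comp[OF open_intervalD(1)[OF I] A null_curveD(2)[OF \<beta>] J \<alpha>]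
  have gram: "mink (nderiv (Suc n) \<alpha> s) (nderiv (Suc n) \<alpha> s)
      = mink (nderiv (Suc n) \<beta> (\<epsilon> * s + d)) (nderiv (Suc n) \<beta> (\<epsilon> * s + d))" if "s \<in> I" for n s
  proof -
    have "\<epsilon> ^ Suc n * \<epsilon> ^ Suc n = 1"
      using \<epsilon> by (auto simp: power_mult_distrib[symmetric] simp del: power_Suc)
    then show ?thesis
      using *[OF _ _ that, of n] by (simp add: mink_linear_simps isom del: power_Suc)
  qed
  have "smooth_curve I \<alpha>"
    using differentiableI_vector[OF conjunct1[OF *]] by (auto simp: smooth_curve_def)
  then show "null_curve I \<alpha>"
    using I gram[of _ 0] gram[of _ 1] null_curveD(3,4)[OF \<beta> J]
    by (intro null_curve_frame.null_curveI null_curve_frame.intro) (auto simp: numeral_2_eq_2 One_nat_def)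
  show "torsion \<alpha> s = torsion \<beta> (\<epsilon> * s + d)" if "s \<in> I"
    using gram[OF that, of 2] by (simp add: torsion_def)
qed

lemma open_interval_affine_image:
  assumes "\<epsilon> \<noteq> 0"
  shows "open_interval ((\<lambda>s. \<epsilon> * s + d) ` I) \<longleftrightarrow> open_interval I"
proof -
  have *: "open_interval ((\<lambda>s. k * s + e) ` K)" if "open_interval K" "k \<noteq> 0" for k e :: real and K
  proof -
    have "open ((\<lambda>s. e + s) ` ((\<lambda>s. k *\<^sub>R s) ` K))"
      using that by (intro open_translation open_scaling) (auto simp: open_interval_def)
    moreover have "connected ((\<lambda>s. k * s + e) ` K)"
      using open_intervalD(3)[OF that(1)] by (intro connected_continuous_image continuous_intros)
    ultimately show ?thesis
      using that by (auto simp: open_interval_def is_interval_connected_1 image_image add.commute)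
  qed
  \<comment> \<open>The inverse change of parameter is affine too, which gives the converse
    direction.\<close>
  have "(\<lambda>s. (1 / \<epsilon>) * s + (- d / \<epsilon>)) ` ((\<lambda>s. \<epsilon> * s + d) ` I) = I"
    using assms by (simp add: image_image field_simps)
  then show ?thesis
    using *[of I \<epsilon> d] *[of "(\<lambda>s. \<epsilon> * s + d) ` I" "1 / \<epsilon>" "- d / \<epsilon>"] assms by auto
qed

section \<open>The explicit curves\<close>

text \<open>This class is closed under differentiation on \<open>(0,\<infinity>)\<close>, which makes the explicit curves smooth.\<close>

inductive elementary :: "(real \<Rightarrow> real) \<Rightarrow> bool" where
  const: "elementary (\<lambda>_. k)"
| ident: "elementary (\<lambda>s. s)"
| ln: "elementary ln"
| powr: "elementary (\<lambda>s. s powr k)"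
| sin: "elementary (\<lambda>s. sin (k * ln s))"
| cos: "elementary (\<lambda>s. cos (k * ln s))"
| add: "elementary f \<Longrightarrow> elementary g \<Longrightarrow> elementary (\<lambda>s. f s + g s)"
| mult: "elementary f \<Longrightarrow> elementary g \<Longrightarrow> elementary (\<lambda>s. f s * g s)"

lemma elementary_minus: "elementary f \<Longrightarrow> elementary (\<lambda>s. - f s)"
  using elementary.mult[OF elementary.const[of "-1"]] by simp

lemma elementary_diff: "elementary f \<Longrightarrow> elementary g \<Longrightarrow> elementary (\<lambda>s. f s - g s)"
  using elementary.add[OF _ elementary_minus] by simp

lemma elementary_divide: "elementary f \<Longrightarrow> elementary (\<lambda>s. f s / k)"
  using elementary.mult[OF _ elementary.const[of "1 / k"]] by simp

lemma elementary_power: "elementary f \<Longrightarrow> elementary (\<lambda>s. f s ^ n)"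
  by (induction n) (auto intro: elementary.intros)

lemmas elementary_intros =
  elementary.intros elementary_minus elementary_diff elementary_divide elementary_power

lemma elementary_has_derivative:
  assumes "elementary f"
  shows "\<exists>f'. elementary f' \<and> (\<forall>s>0. (f has_real_derivative f' s) (at s))"
  using assms
proof induction
  case (const k)
  then show ?case by (intro exI[of _ "\<lambda>_. 0"]) (auto intro: elementary.const)
next
  case ident
  then show ?case by (intro exI[of _ "\<lambda>_. 1"]) (auto intro: elementary.const)
next
  case ln
  then show ?case
    \<comment> \<open>The reciprocal is written as a power because the class has no quotients by
      non-constant functions.\<close>
    by (intro exI[of _ "\<lambda>s. s powr (-1)"] conjI elementary_intros)
      (auto intro!: derivative_eq_intros simp: powr_minus divide_simps)
next
  case (powr k)
  then show ?case
    by (intro exI[of _ "\<lambda>s. k * s powr (k - 1)"] conjI elementary_intros)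
      (auto intro!: has_real_derivative_powr)
next
  case (sin k)
  then show ?case
    by (intro exI[of _ "\<lambda>s. cos (k * ln s) * (k * s powr (-1))"] conjI elementary_intros)
      (auto intro!: derivative_eq_intros simp: powr_minus divide_simps)
next
  case (cos k)
  then show ?case
    by (intro exI[of _ "\<lambda>s. - (sin (k * ln s) * (k * s powr (-1)))"] conjI elementary_intros)
      (auto intro!: derivative_eq_intros simp: powr_minus divide_simps)
next
  case (add f g)
  then obtain f' g' where "elementary f'" "elementary g'"
    "\<forall>s>0. (f has_real_derivative f' s) (at s)" "\<forall>s>0. (g has_real_derivative g' s) (at s)"
    by auto
  then show ?case
    by (intro exI[of _ "\<lambda>s. f' s + g' s"]) (auto intro!: elementary_intros DERIV_add)
next
  case (mult f g)
  then obtain f' g' where "elementary f'" "elementary g'"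
    "\<forall>s>0. (f has_real_derivative f' s) (at s)" "\<forall>s>0. (g has_real_derivative g' s) (at s)"
    by auto
  with mult.hyps show ?case
    by (intro exI[of _ "\<lambda>s. f' s * g s + g' s * f s"]) (auto intro!: elementary_intros DERIV_mult)
qed

lemma has_vector_derivative_vector3:
  assumes "(x has_real_derivative x') (at s)" "(y has_real_derivative y') (at s)"
    "(z has_real_derivative z') (at s)"
  shows "((\<lambda>s. vector [x s, y s, z s] :: real^3) has_vector_derivative vector [x', y', z']) (at s)"
proof -
  \<comment> \<open>Splitting along the coordinate axes reduces the claim to the sum and scaling
    rules.\<close>
  have v: "(vector [p, q, r] :: real^3) = p *\<^sub>R vector [1, 0, 0] + q *\<^sub>R vector [0, 1, 0] + r *\<^sub>R vector [0, 0, 1]"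
    for p q r
    by (simp add: vec_eq_iff forall_3)
  have "((\<lambda>s. x s *\<^sub>R vector [1, 0, 0] + y s *\<^sub>R vector [0, 1, 0] + z s *\<^sub>R vector [0, 0, 1] :: real^3)
    has_vector_derivative (x s *\<^sub>R 0 + x' *\<^sub>R vector [1, 0, 0]) + (y s *\<^sub>R 0 + y' *\<^sub>R vector [0, 1, 0])
      + (z s *\<^sub>R 0 + z' *\<^sub>R vector [0, 0, 1])) (at s)"
    by (intro has_vector_derivative_add has_vector_derivative_scaleR has_vector_derivative_const assms)
  then show ?thesis by (simp flip: v)
qed

text \<open>By induction every iterated derivative again has elementary components on the positive
  axis, hence is differentiable there.\<close>

lemma smooth_curve_elementary:
  assumes "elementary x" "elementary y" "elementary z"
    and \<beta>: "\<And>s. s > 0 \<Longrightarrow> \<beta> s = vector [x s, y s, z s]"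
  shows "smooth_curve {0<..} \<beta>"
proof -
  have step: "\<exists>x' y' z'. elementary x' \<and> elementary y' \<and> elementary z'
      \<and> (\<forall>s>0. (nderiv n \<beta> has_vector_derivative vector [x' s, y' s, z' s]) (at s))"
    if el: "elementary x" "elementary y" "elementary z"
      and n: "\<forall>s>0. nderiv n \<beta> s = vector [x s, y s, z s]" for n x y z
  proof -
    obtain x' y' z' where el': "elementary x'" "elementary y'" "elementary z'"
      and d: "\<forall>s>0. (x has_real_derivative x' s) (at s)" "\<forall>s>0. (y has_real_derivative y' s) (at s)"
      "\<forall>s>0. (z has_real_derivative z' s) (at s)"
      using el[THEN elementary_has_derivative] by auto
    have "(nderiv n \<beta> has_vector_derivative vector [x' s, y' s, z' s]) (at s)" if "s > 0" for s
      by (rule nderiv_Suc_eqI(1)[of "{0<..}" _ _ "\<lambda>s. vector [x s, y s, z s]"])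
        (use d n that in \<open>auto intro!: has_vector_derivative_vector3\<close>)
    then show ?thesis using el' by blast
  qed
  have components: "\<exists>x y z. elementary x \<and> elementary y \<and> elementary z
      \<and> (\<forall>s>0. nderiv n \<beta> s = vector [x s, y s, z s])" for n
  proof (induction n)
    case 0
    then show ?case using assms by (auto simp: nderiv_0)
  next
    case (Suc n)
    then obtain x y z where "elementary x" "elementary y" "elementary z"
      "\<forall>s>0. nderiv n \<beta> s = vector [x s, y s, z s]" by auto
    from step[OF this] show ?case
      by (metis nderiv_Suc vector_derivative_at)
  qed
  show ?thesis
    unfolding smooth_curve_def
  proof (intro allI ballI)
    fix n and s :: real assume s: "s \<in> {0<..}"
    obtain x y z where "elementary x" "elementary y" "elementary z"
      "\<forall>s>0. nderiv n \<beta> s = vector [x s, y s, z s]" using components[of n] by auto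
    from step[OF this] show "nderiv n \<beta> differentiable at s"
      using s by (auto intro: differentiableI_vector)
  qed
qed

text \<open>Reduces each explicit family to coordinatewise derivatives and three scalar identities;
  the last identity is twice the torsion.\<close>

lemma null_curve_elementary:
  assumes el: "elementary x" "elementary y" "elementary z"
    and \<beta>: "\<And>s. s > 0 \<Longrightarrow> \<beta> s = vector [x s, y s, z s]"
    and d1: "\<And>s. s > 0 \<Longrightarrow> (x has_real_derivative x1 s) (at s)"
      "\<And>s. s > 0 \<Longrightarrow> (y has_real_derivative y1 s) (at s)"
      "\<And>s. s > 0 \<Longrightarrow> (z has_real_derivative z1 s) (at s)"
    and d2: "\<And>s. s > 0 \<Longrightarrow> (x1 has_real_derivative x2 s) (at s)"
      "\<And>s. s > 0 \<Longrightarrow> (y1 has_real_derivative y2 s) (at s)"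
      "\<And>s. s > 0 \<Longrightarrow> (z1 has_real_derivative z2 s) (at s)"
    and d3: "\<And>s. s > 0 \<Longrightarrow> (x2 has_real_derivative x3 s) (at s)"
      "\<And>s. s > 0 \<Longrightarrow> (y2 has_real_derivative y3 s) (at s)"
      "\<And>s. s > 0 \<Longrightarrow> (z2 has_real_derivative z3 s) (at s)"
    and gram: "\<And>s. s > 0 \<Longrightarrow> x1 s * x1 s + y1 s * y1 s - z1 s * z1 s = 0"
      "\<And>s. s > 0 \<Longrightarrow> x2 s * x2 s + y2 s * y2 s - z2 s * z2 s = 1"
      "\<And>s. s > 0 \<Longrightarrow> x3 s * x3 s + y3 s * y3 s - z3 s * z3 s = a / s^2"
  shows "null_curve {0<..} \<beta> \<and> (\<forall>s>0. torsion \<beta> s = a / (2 * s^2))"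
proof -
  have nderiv_vector: "nderiv (Suc n) \<beta> s = vector [f' s, g' s, h' s]"
    if "\<And>s. s > 0 \<Longrightarrow> nderiv n \<beta> s = vector [f s, g s, h s]"
      "\<And>s. s > 0 \<Longrightarrow> (f has_real_derivative f' s) (at s)"
      "\<And>s. s > 0 \<Longrightarrow> (g has_real_derivative g' s) (at s)"
      "\<And>s. s > 0 \<Longrightarrow> (h has_real_derivative h' s) (at s)" "s > 0" for n f g h f' g' h' s
    by (rule nderiv_Suc_eqI(2)[of "{0<..}" n \<beta> "\<lambda>s. vector [f s, g s, h s]"
          "\<lambda>s. vector [f' s, g' s, h' s]"])
      (use that in \<open>auto intro!: has_vector_derivative_vector3\<close>)
  have n1: "nderiv 1 \<beta> s = vector [x1 s, y1 s, z1 s]" if "s > 0" for s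
    using nderiv_vector[OF _ d1 that, of 0] \<beta> by (simp add: nderiv_0 One_nat_def)
  have n2: "nderiv 2 \<beta> s = vector [x2 s, y2 s, z2 s]" if "s > 0" for s
    using nderiv_vector[OF n1 d2 that] by simp
  have n3: "nderiv 3 \<beta> s = vector [x3 s, y3 s, z3 s]" if "s > 0" for s
    using nderiv_vector[OF n2 d3 that] by simp
  have "null_curve {0<..} \<beta>"
    by (rule null_curve_frame.null_curveI[OF null_curve_frame.intro[OF _ smooth_curve_elementary[OF el \<beta>]]])
      (auto simp: open_interval_def is_interval_connected_1 n1 n2 mink_def gram)
  moreover have "torsion \<beta> s = a / (2 * s^2)" if "s > 0" for s
    using gram(3)[OF that] that by (simp add: torsion_def n3 mink_def)
  ultimately show ?thesis by blast
qed

section \<open>Derivatives and torsion of the four families\<close>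

text \<open>With u = ln s the tangent is s/2 times (2 u, u^2 - 1, u^2 + 1), the usual rational
  parametrization of the null cone.\<close>

lemma curve_a_null:
  "null_curve {0<..} curve_a \<and> (\<forall>s>0. torsion curve_a s = 1 / (2 * s^2))"
  by (rule null_curve_elementary[where
      x = "\<lambda>s. (s^2 / 8) * (2 * (2 * ln s - 1))"
      and y = "\<lambda>s. (s^2 / 8) * (2 * (ln s)^2 - 2 * ln s - 1)"
      and z = "\<lambda>s. (s^2 / 8) * (2 * (ln s)^2 - 2 * ln s + 3)"
      and ?x1.0 = "\<lambda>s. s * ln s" and ?y1.0 = "\<lambda>s. s / 2 * ((ln s)^2 - 1)"
      and ?z1.0 = "\<lambda>s. s / 2 * ((ln s)^2 + 1)"
      and ?x2.0 = "\<lambda>s. ln s + 1" and ?y2.0 = "\<lambda>s. ((ln s)^2 - 1) / 2 + ln s"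
      and ?z2.0 = "\<lambda>s. ((ln s)^2 + 1) / 2 + ln s"
      and ?x3.0 = "\<lambda>s. 1 / s" and ?y3.0 = "\<lambda>s. (ln s + 1) / s" and ?z3.0 = "\<lambda>s. (ln s + 1) / s"])
    ((intro elementary_intros)+, auto intro!: derivative_eq_intros
      simp: curve_a_def vec_eq_iff forall_3 field_simps power2_eq_square power3_eq_cube power4_eq_xxxx)

text \<open>The tangent is that of \<open>curve_c\<close> put formally at b = 2, where the power
  s^(1 - b) becomes 1/s and integrates to a logarithm.\<close>

lemma curve_d_null:
  "null_curve {0<..} curve_d \<and> (\<forall>s>0. torsion curve_d s = - 3 / (2 * s^2))"
  by (rule null_curve_elementary[where
      x = "\<lambda>s. - (s^2 / 4)"
      and y = "\<lambda>s. (s^4 - 4 * ln s) / 16"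
      and z = "\<lambda>s. (- (s^4) - 4 * ln s) / 16"
      and ?x1.0 = "\<lambda>s. - s / 2" and ?y1.0 = "\<lambda>s. s^3 / 4 - 1 / (4 * s)"
      and ?z1.0 = "\<lambda>s. - (s^3) / 4 - 1 / (4 * s)"
      and ?x2.0 = "\<lambda>s. - 1 / 2" and ?y2.0 = "\<lambda>s. 3 * s^2 / 4 + 1 / (4 * s^2)"
      and ?z2.0 = "\<lambda>s. - 3 * s^2 / 4 + 1 / (4 * s^2)"
      and ?x3.0 = "\<lambda>s. 0" and ?y3.0 = "\<lambda>s. 3 * s / 2 - 1 / (2 * s^3)"
      and ?z3.0 = "\<lambda>s. - 3 * s / 2 - 1 / (2 * s^3)"])
    ((intro elementary_intros)+, auto intro!: derivative_eq_intros
      simp: curve_d_def vec_eq_iff forall_3 field_simps power2_eq_square power3_eq_cube power4_eq_xxxx)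

text \<open>Stated with products to match terms after \<open>power2_eq_square\<close>, so that the
  metric identities of \<open>curve_b\<close> reduce to polynomials in the cosine.\<close>

lemma sin_mult_sin_eq: "sin x * sin x = 1 - cos x * cos (x::real)"
  by (simp add: sin_squared_eq flip: power2_eq_square)

lemma curve_b_null:
  assumes "a > 1"
  shows "null_curve {0<..} (curve_b a) \<and> (\<forall>s>0. torsion (curve_b a) s = a / (2 * s^2))"
proof -
  define b where "b = sqrt (a - 1)"
  have b: "b > 0" and a: "a = b^2 + 1" using assms by (simp_all add: b_def)
  have b4: "b^2 + 4 \<noteq> 0" using zero_le_power2[of b] by linarith
  show ?thesis
  proof (rule null_curve_elementary[where
      x = "\<lambda>s. s^2 * (2 * sin (b * ln s) - b * cos (b * ln s)) / (b^2 + 4) / b"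
      and y = "\<lambda>s. - (s^2 * (2 * cos (b * ln s) + b * sin (b * ln s))) / (b^2 + 4) / b"
      and z = "\<lambda>s. s^2 / (2 * b)"
      and ?x1.0 = "\<lambda>s. s * sin (b * ln s) / b" and ?y1.0 = "\<lambda>s. - (s * cos (b * ln s)) / b"
      and ?z1.0 = "\<lambda>s. s / b"
      and ?x2.0 = "\<lambda>s. sin (b * ln s) / b + cos (b * ln s)"
      and ?y2.0 = "\<lambda>s. - cos (b * ln s) / b + sin (b * ln s)"
      and ?z2.0 = "\<lambda>s. 1 / b"
      and ?x3.0 = "\<lambda>s. (cos (b * ln s) - b * sin (b * ln s)) / s"
      and ?y3.0 = "\<lambda>s. (sin (b * ln s) + b * cos (b * ln s)) / s"
      and ?z3.0 = "\<lambda>s. 0"])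
    fix s :: real assume s: "s > 0"
    show "curve_b a s = vector
      [s^2 * (2 * sin (b * ln s) - b * cos (b * ln s)) / (b^2 + 4) / b,
       - (s^2 * (2 * cos (b * ln s) + b * sin (b * ln s))) / (b^2 + 4) / b, s^2 / (2 * b)]"
      using s by (simp add: curve_b_def b_def[symmetric] vec_eq_iff forall_3 ln_powr)
    \<comment> \<open>The derivative of the bare numerator carries the factor
      \<open>b^2 + 4\<close>, which then cancels against the denominator.\<close>
    have "((\<lambda>s. s^2 * (2 * sin (b * ln s) - b * cos (b * ln s))) has_real_derivative
        (s * sin (b * ln s)) * (b^2 + 4)) (at s)"
      using s by (auto intro!: derivative_eq_intros simp: field_simps power2_eq_square)
    from DERIV_cdivide[OF DERIV_cdivide[OF this, of "b^2 + 4"], of b]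
    show "((\<lambda>s. s^2 * (2 * sin (b * ln s) - b * cos (b * ln s)) / (b^2 + 4) / b)
        has_real_derivative s * sin (b * ln s) / b) (at s)"
      using b4 by simp
    have "((\<lambda>s. - (s^2 * (2 * cos (b * ln s) + b * sin (b * ln s)))) has_real_derivative
        - (s * cos (b * ln s)) * (b^2 + 4)) (at s)"
      using s by (auto intro!: derivative_eq_intros simp: field_simps power2_eq_square)
    from DERIV_cdivide[OF DERIV_cdivide[OF this, of "b^2 + 4"], of b]
    show "((\<lambda>s. - (s^2 * (2 * cos (b * ln s) + b * sin (b * ln s))) / (b^2 + 4) / b)
        has_real_derivative - (s * cos (b * ln s)) / b) (at s)"
      using b4 by simp
  qed ((intro elementary_intros)+, use b in \<open>auto intro!: derivative_eq_intros
      simp: a sin_mult_sin_eq field_simps power2_eq_square\<close>)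
qed

lemma curve_c_null:
  assumes "a < 1" "a \<noteq> -3"
  shows "null_curve {0<..} (curve_c a) \<and> (\<forall>s>0. torsion (curve_c a) s = a / (2 * s^2))"
proof -
  define b where "b = sqrt (1 - a)"
  have b: "b > 0" and a: "a = 1 - b^2" using assms by (simp_all add: b_def)
  have "b \<noteq> 2" using a assms(2) by auto
  \<comment> \<open>Applied with \<open>k\<close> equal to \<open>b\<close> and to
    \<open>-b\<close>; the second use requires \<open>b \<noteq> 2\<close>, that is,
    \<open>a \<noteq> -3\<close>.\<close>
  have deriv: "((\<lambda>s. s^2 * s powr k / (k + 2)) has_real_derivative s * s powr k) (at s)"
    if s: "s > 0" and k: "k + 2 \<noteq> 0" for k s :: real
  proof -
    have "((\<lambda>s. s^2 * s powr k) has_real_derivative (s * s powr k) * (k + 2)) (at s)"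
      using s by (auto intro!: derivative_eq_intros simp: field_simps power2_eq_square powr_diff)
    from DERIV_cdivide[OF this, of "k + 2"] show ?thesis using k by simp
  qed
  show ?thesis
  proof (rule null_curve_elementary[where
      x = "\<lambda>s. - (s^2 / (2 * b))"
      and y = "\<lambda>s. (s^2 * s powr b / (b + 2) - s^2 * s powr (-b) / (-b + 2)) / (2 * b)"
      and z = "\<lambda>s. (- (s^2 * s powr b / (b + 2)) - s^2 * s powr (-b) / (-b + 2)) / (2 * b)"
      and ?x1.0 = "\<lambda>s. - s / b"
      and ?y1.0 = "\<lambda>s. (s * s powr b - s * s powr (-b)) / (2 * b)"
      and ?z1.0 = "\<lambda>s. (- (s * s powr b) - s * s powr (-b)) / (2 * b)"
      and ?x2.0 = "\<lambda>s. - 1 / b"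
      and ?y2.0 = "\<lambda>s. ((1 + b) * s powr b - (1 - b) * s powr (-b)) / (2 * b)"
      and ?z2.0 = "\<lambda>s. (- ((1 + b) * s powr b) - (1 - b) * s powr (-b)) / (2 * b)"
      and ?x3.0 = "\<lambda>s. 0"
      and ?y3.0 = "\<lambda>s. ((1 + b) * s powr b + (1 - b) * s powr (-b)) / (2 * s)"
      and ?z3.0 = "\<lambda>s. (- ((1 + b) * s powr b) + (1 - b) * s powr (-b)) / (2 * s)"])
    fix s :: real assume s: "s > 0"
    \<comment> \<open>The definition of \<open>curve_c\<close> divides by \<open>b - 2\<close>,
      whereas \<open>deriv\<close> with \<open>-b\<close> produces the denominator
      \<open>-b + 2\<close>.\<close>
    have "u / (b - 2) = - (u / (-b + 2))" for u
      using minus_divide_right[of u "b - 2"] by simp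
    then show "curve_c a s = vector [- (s^2 / (2 * b)),
       (s^2 * s powr b / (b + 2) - s^2 * s powr (-b) / (-b + 2)) / (2 * b),
       (- (s^2 * s powr b / (b + 2)) - s^2 * s powr (-b) / (-b + 2)) / (2 * b)]"
      by (simp add: curve_c_def b_def[symmetric] vec_eq_iff forall_3 algebra_simps
          add_divide_distrib diff_divide_distrib)
    have 1: "((\<lambda>s. s^2 * s powr b / (b + 2)) has_real_derivative s * s powr b) (at s)"
      by (rule deriv) (use s b in auto)
    have 2: "((\<lambda>s. s^2 * s powr (-b) / (-b + 2)) has_real_derivative s * s powr (-b)) (at s)"
      by (rule deriv) (use s \<open>b \<noteq> 2\<close> in auto)
    show "((\<lambda>s. (s^2 * s powr b / (b + 2) - s^2 * s powr (-b) / (-b + 2)) / (2 * b))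
        has_real_derivative (s * s powr b - s * s powr (-b)) / (2 * b)) (at s)"
      by (intro DERIV_cdivide DERIV_diff 1 2)
    show "((\<lambda>s. (- (s^2 * s powr b / (b + 2)) - s^2 * s powr (-b) / (-b + 2)) / (2 * b))
        has_real_derivative (- (s * s powr b) - s * s powr (-b)) / (2 * b)) (at s)"
      by (intro DERIV_cdivide DERIV_diff DERIV_minus 1 2)
  qed ((intro elementary_intros)+, use b in \<open>auto intro!: derivative_eq_intros
      simp: a field_simps power2_eq_square powr_diff powr_minus\<close>)
qed

section \<open>Matching the torsion constant with the four families\<close>

theorem corollary2:
  shows "(\<forall>I \<alpha>. null_slant_helix I \<alpha> \<and> \<not> null_general_helix I \<alpha> \<longleftrightarrow>
            (\<exists>J \<beta>. open_interval J \<and> J \<subseteq> {0<..} \<and> congruent_curves I \<alpha> J \<beta> \<and>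
               (\<beta> = curve_a \<or>
                (\<exists>a>1. \<beta> = curve_b a) \<or>
                (\<exists>a<1. a \<noteq> 0 \<and> a \<noteq> -3 \<and> \<beta> = curve_c a) \<or>
                \<beta> = curve_d)))
       \<and> (\<forall>s>0. torsion curve_a s = 1 / (2 * s^2))
       \<and> (\<forall>a>1. \<forall>s>0. torsion (curve_b a) s = a / (2 * s^2))
       \<and> (\<forall>a<1. a \<noteq> 0 \<and> a \<noteq> -3 \<longrightarrow> (\<forall>s>0. torsion (curve_c a) s = a / (2 * s^2)))
       \<and> (\<forall>s>0. torsion curve_d s = - (3 / (2 * s^2)))"
proof -
  define family where "family \<beta> \<longleftrightarrow> \<beta> = curve_a \<or> (\<exists>a>1. \<beta> = curve_b a) \<or>
    (\<exists>a<1. a \<noteq> 0 \<and> a \<noteq> -3 \<and> \<beta> = curve_c a) \<or> \<beta> = curve_d" for \<beta>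
  have family_torsion: "\<exists>a. a \<noteq> 0 \<and> null_curve {0<..} \<beta> \<and> (\<forall>s>0. torsion \<beta> s = a / (2 * s^2))"
    if "family \<beta>" for \<beta>
    using that unfolding family_def
  proof (elim disjE exE conjE)
    assume "\<beta> = curve_a"
    then show ?thesis using curve_a_null by (intro exI[of _ 1]) simp
  next
    fix a :: real assume "a > 1" "\<beta> = curve_b a"
    then show ?thesis using curve_b_null by (intro exI[of _ a]) simp
  next
    fix a :: real assume "a < 1" "a \<noteq> 0" "a \<noteq> -3" "\<beta> = curve_c a"
    then show ?thesis using curve_c_null by (intro exI[of _ a]) simp
  next
    assume "\<beta> = curve_d"
    then show ?thesis using curve_d_null by (intro exI[of _ "- 3"]) simp
  qed
  have torsion_family: "\<exists>\<beta>. family \<beta> \<and> null_curve {0<..} \<beta> \<and> (\<forall>s>0. torsion \<beta> s = a / (2 * s^2))"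
    if "a \<noteq> 0" for a
  proof -
    \<comment> \<open>The values 1 and -3 are set apart because b = 0 and b = 2 make denominators in
      the generic families vanish.\<close>
    consider "a = 1" | "a = -3" | "a > 1" | "a < 1" "a \<noteq> -3" by linarith
    then show ?thesis
    proof cases
      case 1
      then show ?thesis using curve_a_null by (auto simp: family_def)
    next
      case 2
      then show ?thesis using curve_d_null by (auto simp: family_def)
    next
      case 3
      then show ?thesis using curve_b_null by (auto simp: family_def)
    next
      case 4
      then show ?thesis using curve_c_null that by (auto simp: family_def)
    qed
  qed
  have "null_slant_helix I \<alpha> \<and> \<not> null_general_helix I \<alpha> \<longleftrightarrow>
      (\<exists>J \<beta>. open_interval J \<and> J \<subseteq> {0<..} \<and> congruent_curves I \<alpha> J \<beta> \<and> family \<beta>)"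
    (is "?L \<longleftrightarrow> ?R") for I \<alpha>
  proof
    assume L: ?L
    then have \<alpha>: "null_curve I \<alpha>" by (simp add: null_slant_helix_def)
    obtain a \<epsilon> d where a: "a \<noteq> 0" and \<epsilon>: "\<epsilon> = 1 \<or> \<epsilon> = -1"
      and pos: "\<And>s. s \<in> I \<Longrightarrow> \<epsilon> * s + d > 0"
      and \<tau>: "\<And>s. s \<in> I \<Longrightarrow> torsion \<alpha> s = a / (2 * (\<epsilon> * s + d)^2)"
      using slant_not_general_imp_torsion L by meson
    obtain \<beta> where \<beta>: "family \<beta>" "null_curve {0<..} \<beta>" "\<forall>s>0. torsion \<beta> s = a / (2 * s^2)"
      using torsion_family[OF a] by auto
    define J where "J = (\<lambda>s. \<epsilon> * s + d) ` I"
    \<comment> \<open>The model curve is pulled back to \<open>I\<close>, so that two curves with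
      the same domain and torsion can be compared.\<close>
    define \<gamma> where "\<gamma> s = \<beta> (\<epsilon> * s + d)" for s
    have \<gamma>: "null_curve I \<gamma>" "\<And>s. s \<in> I \<Longrightarrow> torsion \<gamma> s = torsion \<beta> (\<epsilon> * s + d)"
      using null_curve_affine_comp[OF null_curveD(1)[OF \<alpha>] linear_id _ \<epsilon> \<beta>(2), of d \<gamma> 0] pos
      by (auto simp: \<gamma>_def)
    have "torsion \<alpha> s = torsion \<gamma> s" if "s \<in> I" for s
      using that \<tau> \<gamma>(2) \<beta>(3) pos by simp
    then obtain \<Phi> where "mink_isometry \<Phi>" "\<forall>s\<in>I. \<alpha> s = \<Phi> (\<gamma> s)"
      using torsion_determines_null_curve[OF \<alpha> \<gamma>(1)] by auto
    then have "congruent_curves I \<alpha> J \<beta>"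
      using \<epsilon> unfolding congruent_curves_def J_def \<gamma>_def by blast
    moreover have "open_interval J"
      unfolding J_def using \<epsilon> null_curveD(1)[OF \<alpha>] by (subst open_interval_affine_image) auto
    moreover have "J \<subseteq> {0<..}" using pos by (auto simp: J_def)
    ultimately show ?R using \<beta>(1) by auto
  next
    assume ?R
    then obtain J \<beta> where J: "open_interval J" "J \<subseteq> {0<..}" and \<beta>: "family \<beta>"
      and cong: "congruent_curves I \<alpha> J \<beta>" by auto
    obtain \<epsilon> d \<Phi> where \<epsilon>: "\<epsilon> = 1 \<or> \<epsilon> = -1" and \<Phi>: "mink_isometry \<Phi>"
      and J_eq: "J = (\<lambda>s. \<epsilon> * s + d) ` I" and \<alpha>\<Phi>: "\<And>s. s \<in> I \<Longrightarrow> \<alpha> s = \<Phi> (\<beta> (\<epsilon> * s + d))"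
      using cong unfolding congruent_curves_def by blast
    obtain A p where A: "linear A" "\<And>u v. mink (A u) (A v) = mink u v" and "\<And>x. \<Phi> x = A x + p"
      using \<Phi> unfolding mink_isometry_def by blast
    then have \<alpha>: "\<alpha> s = A (\<beta> (\<epsilon> * s + d)) + p" if "s \<in> I" for s
      using \<alpha>\<Phi>[OF that] by simp
    obtain a where a: "a \<noteq> 0" "null_curve {0<..} \<beta>" "\<forall>s>0. torsion \<beta> s = a / (2 * s^2)"
      using family_torsion[OF \<beta>] by auto
    have "\<epsilon> \<noteq> 0" using \<epsilon> by auto
    \<comment> \<open>\<open>congruent_curves\<close> speaks only of the image \<open>J\<close>, so
      the interval property of \<open>I\<close> is recovered through the affine bijection.\<close>
    then have I: "open_interval I" using J(1) J_eq by (simp add: open_interval_affine_image)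
    have pos: "\<epsilon> * s + d \<in> {0<..}" if "s \<in> I" for s using J(2) J_eq that by auto
    show ?L
    proof (rule torsion_imp_slant_not_general[OF _ a(1) \<open>\<epsilon> \<noteq> 0\<close>])
      show "null_curve I \<alpha>"
        by (rule null_curve_affine_comp(1)[OF I A \<epsilon> a(2) pos \<alpha>])
      show "\<epsilon> * s + d \<noteq> 0 \<and> torsion \<alpha> s = a / (2 * (\<epsilon> * s + d)^2)" if "s \<in> I" for s
        using null_curve_affine_comp(2)[OF I A \<epsilon> a(2) pos \<alpha> that] a(3) pos[OF that] by simp
    qed
  qed
  then show ?thesis
    using curve_a_null curve_b_null curve_c_null curve_d_null by (simp add: family_def)
qed

end
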